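(* There is no nonzero symplectically irreducible symplectic Lie algebra of dimension less than $6$.
   Context: All Lie algebras are real and finite-dimensional. A symplectic Lie algebra $(\mathfrak g,[\cdot,\cdot],\omega)$ is a Lie algebra with a nondegenerate skew-symmetric bilinear form $\omega$ satisfying $\omega([x,y],z)+\omega([y,z],x)+\omega([z,x],y)=0$ for all $x,y,z\in\mathfrak g$. A subspace $\mathfrak m$ is isotropic if $\omega(x,y)=0$ for all $x,y\in\mathfrak m$. A symplectic Lie algebra is symplectically irreducible if it contains no nonzero isotropic ideal. *)

theory Defs
  imports "HOL-Analysis.Analysis"
begin

text \<open>
  The underlying real vector space is a whole type of class \<open>real_vector\<close>; brackets and forms
  are plain functions on it. Finite-dimensionality is part of being a Lie algebra here and has to
  be required explicitly, because \<open>dim\<close> is \<open>0\<close> on infinite-dimensional spaces.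
\<close>

definition lie_algebra :: "('a::real_vector \<Rightarrow> 'a \<Rightarrow> 'a) \<Rightarrow> bool" where
  "lie_algebra br \<longleftrightarrow>
     (\<exists>B::'a set. finite B \<and> span B = UNIV) \<and>
     bilinear br \<and>
     (\<forall>x. br x x = 0) \<and>
     (\<forall>x y z. br x (br y z) + br y (br z x) + br z (br x y) = 0)"

definition nondegenerate_form :: "('a::real_vector \<Rightarrow> 'a \<Rightarrow> real) \<Rightarrow> bool" where
  "nondegenerate_form \<omega> \<longleftrightarrow> (\<forall>x. (\<forall>y. \<omega> x y = 0) \<longrightarrow> x = 0)"

definition symplectic_lie_algebra ::
    "('a::real_vector \<Rightarrow> 'a \<Rightarrow> 'a) \<Rightarrow> ('a \<Rightarrow> 'a \<Rightarrow> real) \<Rightarrow> bool" where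
  "symplectic_lie_algebra br \<omega> \<longleftrightarrow>
     lie_algebra br \<and>
     bilinear \<omega> \<and>
     (\<forall>x y. \<omega> x y = - \<omega> y x) \<and>
     nondegenerate_form \<omega> \<and>
     (\<forall>x y z. \<omega> (br x y) z + \<omega> (br y z) x + \<omega> (br z x) y = 0)"

definition lie_ideal :: "('a::real_vector \<Rightarrow> 'a \<Rightarrow> 'a) \<Rightarrow> 'a set \<Rightarrow> bool" where
  "lie_ideal br I \<longleftrightarrow> subspace I \<and> (\<forall>x. \<forall>y\<in>I. br x y \<in> I)"

definition isotropic :: "('a::real_vector \<Rightarrow> 'a \<Rightarrow> real) \<Rightarrow> 'a set \<Rightarrow> bool" where
  "isotropic \<omega> M \<longleftrightarrow> subspace M \<and> (\<forall>x\<in>M. \<forall>y\<in>M. \<omega> x y = 0)"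

text \<open>With this definition the zero Lie algebra is symplectically irreducible.\<close>

definition symplectically_irreducible ::
    "('a::real_vector \<Rightarrow> 'a \<Rightarrow> 'a) \<Rightarrow> ('a \<Rightarrow> 'a \<Rightarrow> real) \<Rightarrow> bool" where
  "symplectically_irreducible br \<omega> \<longleftrightarrow>
     \<not> (\<exists>I. lie_ideal br I \<and> isotropic \<omega> I \<and> I \<noteq> {0})"

end

theory Submission
  imports Defs
begin

text \<open>
  Suppose a nonzero symplectic Lie algebra of dimension below 6 has no nonzero isotropic
  ideal. A line is isotropic, so no line is an ideal (\<open>no_ideal_line\<close>); this is how most
  contradictions below arise. A symplectic basis has an even number of elements, so the dimension is
  2 or 4. For an ideal \<open>J\<close> of least positive dimension the derived ideal
  \<open>[J, J] \<subseteq> J\<close> is either zero or all of \<open>J\<close>. Both cases are impossible.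

  Abelian ideals (\<open>abelian_ideal_zero\<close>). For an abelian ideal \<open>J\<close> the radical
  \<open>J \<inter> J\<^sup>\<bottom>\<close> of the restricted form is again an ideal, and it is
  isotropic, so \<open>\<omega>\<close> is nondegenerate on \<open>J\<close>. If \<open>J\<close> is the whole algebra, every line is
  an ideal. Otherwise \<open>J\<close> is a plane and its orthogonal complement is a two-dimensional
  subalgebra, which closedness of \<open>\<omega>\<close> forces to act on \<open>J\<close> by matrices in
  \<open>sp(2) = sl(2)\<close>. Either a line of the complement acts trivially and is an ideal, or the action
  preserves a line of \<open>J\<close>, which is then an ideal (\<open>plane_action_impossible\<close>).

  Perfect ideals (\<open>perfect_ideal_zero\<close>). If \<open>dim J \<le> 2\<close>, brackets of two spanning vectors
  fill at most a line. If \<open>dim J\<close> is 3 or 4, the algebra carries a nondegenerate two-form that is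
  exact, that is, of the form \<open>(x, y) \<mapsto> \<alpha> [x, y]\<close>, and all inner derivations have trace zero.
  These two properties exclude each other (\<open>exact_not_unimodular\<close>): the vector \<open>v\<close> dual to
  \<open>\<alpha>\<close> satisfies \<open>ad v + (ad v)\<^sup>* = 1\<close>, where the star denotes the adjoint for the form, and
  since adjoints have equal traces the trace of \<open>ad v\<close> is half the dimension.
\<close>

section \<open>Finite-dimensional linear algebra\<close>

text \<open>
  A finite spanning set contains a basis, and this makes the theory of finite-dimensional vector
  spaces applicable to the whole type.
\<close>

lemma finite_dimensional_facts:
  fixes S :: "'a::real_vector set"
  assumes "finite S" "span S = UNIV"
  shows independent_card_le_dim_UNIV: "independent (B::'a set) \<Longrightarrow> finite B \<and> card B \<le> dim (UNIV::'a set)"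
    and dim_less_of_psubset: "subspace U \<Longrightarrow> subspace V \<Longrightarrow> U \<subset> V \<Longrightarrow> dim U < dim (V::'a set)"
    and basis_of_subspace: "\<exists>B\<subseteq>V. independent B \<and> span B = span V \<and> finite B \<and> card B = dim (V::'a set)"
    and independent_of_spanning: "finite C \<Longrightarrow> card C \<le> dim V \<Longrightarrow> V \<subseteq> span C \<Longrightarrow> C \<subseteq> V \<Longrightarrow> independent (C::'a set)"
    and spanning_of_independent: "independent C \<Longrightarrow> dim (UNIV::'a set) \<le> card C \<Longrightarrow> span C = (UNIV::'a set)"
proof -
  obtain Bs where Bs: "Bs \<subseteq> S" "independent Bs" "S \<subseteq> span Bs"
    using maximal_independent_subset by blast
  have sp: "span Bs = UNIV"
    using Bs assms by (metis UNIV_eq_I span_mono span_span subset_UNIV top.extremum_unique)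
  have fin: "finite Bs" using Bs(1) assms(1) finite_subset by blast
  interpret fd: finite_dimensional_vector_space "scaleR :: real \<Rightarrow> 'a \<Rightarrow> 'a" Bs
    rewrites "module.dependent (*\<^sub>R) = dependent"
    and "module.subspace (*\<^sub>R) = subspace"
    and "module.span (*\<^sub>R) = span"
    and "vector_space.dim (*\<^sub>R) = dim"
    using fin Bs sp by unfold_locales (auto simp: dependent_raw_def subspace_raw_def span_raw_def dim_raw_def)
  show "independent B \<Longrightarrow> finite B \<and> card B \<le> dim (UNIV::'a set)"
    using fd.finiteI_independent fd.independent_card_le_dim[OF subset_UNIV] by blast
  show "subspace U \<Longrightarrow> subspace V \<Longrightarrow> U \<subset> V \<Longrightarrow> dim U < dim (V::'a set)"
    by (metis fd.dim_psubset span_eq_iff)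
  show "\<exists>B\<subseteq>V. independent B \<and> span B = span V \<and> finite B \<and> card B = dim (V::'a set)"
    by (metis basis_exists fd.finiteI_independent span_eq span_superset subset_trans)
  show "finite C \<Longrightarrow> card C \<le> dim V \<Longrightarrow> V \<subseteq> span C \<Longrightarrow> C \<subseteq> V \<Longrightarrow> independent (C::'a set)"
    by (metis fd.card_le_dim_spanning)
  show "independent C \<Longrightarrow> dim (UNIV::'a set) \<le> card C \<Longrightarrow> span C = (UNIV::'a set)"
    by (metis fd.card_ge_dim_independent subset_UNIV top.extremum_unique)
qed

lemma functional_vanishing_on_subspace:
  fixes S :: "'a::real_vector set"
  assumes "subspace S" "S \<noteq> UNIV"
  obtains \<alpha> :: "'a \<Rightarrow> real" where "linear \<alpha>" "\<And>x. x \<in> S \<Longrightarrow> \<alpha> x = 0" "\<alpha> \<noteq> (\<lambda>x. 0)"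
proof -
  obtain x where x: "x \<notin> S" using assms by auto
  obtain B where B: "B \<subseteq> S" "independent B" "S \<subseteq> span B"
    using maximal_independent_subset by blast
  have spB: "span B = S" using B assms by (simp add: span_minimal subset_antisym)
  have ind: "independent (insert x B)" using B x spB by (simp add: independent_insertI)
  obtain \<alpha> :: "'a \<Rightarrow> real" where a: "linear \<alpha>" "\<forall>y\<in>insert x B. \<alpha> y = (if y = x then 1 else 0)"
    using linear_independent_extend[OF ind, of "\<lambda>y. if y = x then 1 else 0"] by blast
  have "\<alpha> y = 0" if "y \<in> S" for y
  proof -
    have "\<alpha> b = 0" if "b \<in> B" for b using a(2) that x B by auto
    then show ?thesis using that linear_eq_0_on_span[OF a(1), of B] spB by auto
  qed
  moreover have "\<alpha> \<noteq> (\<lambda>x. 0)" using a(2) by (metis insertI1 zero_neq_one)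
  ultimately show ?thesis using that a(1) by blast
qed

section \<open>Traces\<close>

text \<open>
  Traces are computed in spanning families with coefficient functionals, so that a symplectic basis,
  whose coefficients are values of the form, and an ordinary basis are treated alike.
\<close>

definition dual_frame :: "'i set \<Rightarrow> ('i \<Rightarrow> 'a::real_vector) \<Rightarrow> ('i \<Rightarrow> 'a \<Rightarrow> real) \<Rightarrow> bool" where
  "dual_frame I b \<beta> \<longleftrightarrow> finite I \<and> (\<forall>i\<in>I. linear (\<beta> i)) \<and> (\<forall>x. (\<Sum>i\<in>I. \<beta> i x *\<^sub>R b i) = x)"

definition frame_trace :: "'i set \<Rightarrow> ('i \<Rightarrow> 'a::real_vector) \<Rightarrow> ('i \<Rightarrow> 'a \<Rightarrow> real) \<Rightarrow> ('a \<Rightarrow> 'a) \<Rightarrow> real" where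
  "frame_trace I b \<beta> A = (\<Sum>i\<in>I. \<beta> i (A (b i)))"

lemma frame_apply:
  assumes "dual_frame I b \<beta>" "linear g"
  shows "g x = (\<Sum>i\<in>I. \<beta> i x *\<^sub>R g (b i))"
proof -
  have "g x = g (\<Sum>i\<in>I. \<beta> i x *\<^sub>R b i)" using assms by (simp add: dual_frame_def)
  then show ?thesis by (simp add: linear_sum[OF assms(2)] linear_scale[OF assms(2)])
qed

text \<open>
  The identity \<open>tr (A B) = tr (B A)\<close>, with a different frame on each side: expanding the inner
  vector in the other frame gives the same double sum twice. Taking \<open>B\<close> to be the identity shows
  that the trace does not depend on the frame.
\<close>

lemma frame_trace_comp:
  assumes f: "dual_frame I b \<beta>" and g: "dual_frame J c \<gamma>" and A: "linear A" and B: "linear B"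
  shows "frame_trace I b \<beta> (\<lambda>x. A (B x)) = frame_trace J c \<gamma> (\<lambda>x. B (A x))"
proof -
  have 1: "\<beta> i (A (B (b i))) = (\<Sum>j\<in>J. \<gamma> j (B (b i)) * \<beta> i (A (c j)))" if "i \<in> I" for i
  proof -
    have "linear (\<lambda>x. \<beta> i (A x))"
      using f that A linear_compose[of A "\<beta> i"] by (simp add: dual_frame_def o_def)
    from frame_apply[OF g this, of "B (b i)"] show ?thesis by simp
  qed
  have 2: "\<gamma> j (B (A (c j))) = (\<Sum>i\<in>I. \<beta> i (A (c j)) * \<gamma> j (B (b i)))" if "j \<in> J" for j
  proof -
    have "linear (\<lambda>x. \<gamma> j (B x))"
      using g that B linear_compose[of B "\<gamma> j"] by (simp add: dual_frame_def o_def)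
    from frame_apply[OF f this, of "A (c j)"] show ?thesis by simp
  qed
  have "frame_trace I b \<beta> (\<lambda>x. A (B x)) = (\<Sum>i\<in>I. \<Sum>j\<in>J. \<gamma> j (B (b i)) * \<beta> i (A (c j)))"
    unfolding frame_trace_def by (rule sum.cong) (simp_all add: 1)
  also have "\<dots> = (\<Sum>j\<in>J. \<Sum>i\<in>I. \<beta> i (A (c j)) * \<gamma> j (B (b i)))"
    by (subst sum.swap) (simp add: mult.commute)
  also have "\<dots> = frame_trace J c \<gamma> (\<lambda>x. B (A x))"
    unfolding frame_trace_def by (rule sum.cong) (simp_all add: 2)
  finally show ?thesis .
qed

lemma frame_trace_unique:
  assumes "dual_frame I b \<beta>" "dual_frame J c \<gamma>" "linear A"
  shows "frame_trace I b \<beta> A = frame_trace J c \<gamma> A"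
  using frame_trace_comp[OF assms(1,2,3) linear_id] by (simp add: id_def)

lemma dual_frame_basis:
  assumes "finite B" "independent B" "span B = UNIV"
  shows "dual_frame B (\<lambda>b. b) (\<lambda>b x. representation B x b)"
  unfolding dual_frame_def
proof (intro conjI ballI allI)
  show "finite B" by fact
  show "linear (\<lambda>x. representation B x b)" for b
    using assms by (intro linearI) (simp_all add: representation_add representation_scale)
  show "(\<Sum>i\<in>B. representation B x i *\<^sub>R i) = x" for x
    using assms by (intro sum_representation_eq) auto
qed

section \<open>Lie algebras, derived ideals and traces of inner derivations\<close>

locale real_lie_algebra =
  fixes br :: "'a::real_vector \<Rightarrow> 'a \<Rightarrow> 'a"
  assumes lie: "lie_algebra br"
begin

lemma bilinear_br: "bilinear br"
  using lie by (simp add: lie_algebra_def)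

lemmas br_simps [simp] =
  bilinear_ladd[OF bilinear_br] bilinear_radd[OF bilinear_br]
  bilinear_lsub[OF bilinear_br] bilinear_rsub[OF bilinear_br]
  bilinear_lmul[OF bilinear_br] bilinear_rmul[OF bilinear_br]
  bilinear_lneg[OF bilinear_br] bilinear_rneg[OF bilinear_br]
  bilinear_lzero[OF bilinear_br] bilinear_rzero[OF bilinear_br]

lemma br_self [simp]: "br x x = 0"
  using lie by (simp add: lie_algebra_def)

lemma br_skew: "br x y = - br y x"
proof -
  have "br (x + y) (x + y) = 0" by (rule br_self)
  then show ?thesis by (simp add: add_eq_0_iff del: br_self) (simp add: add_eq_0_iff)
qed

lemma jacobi: "br x (br y z) + br y (br z x) + br z (br x y) = 0"
  using lie by (simp add: lie_algebra_def)

lemma linear_ad: "linear (br x)"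
  using bilinear_br by (simp add: bilinear_def)

lemma ad_bracket: "br (br x y) z = br x (br y z) - br y (br x z)"
  using jacobi[of x y z] br_skew[of z x] br_skew[of "br x y" z]
  by (simp add: algebra_simps add_eq_0_iff)

lemma finite_dimensional: obtains S :: "'a set" where "finite S" "span S = UNIV"
  using lie by (auto simp: lie_algebra_def)

definition derived :: "'a set \<Rightarrow> 'a set" where
  "derived S = span {br x y |x y. x \<in> S \<and> y \<in> S}"

lemma derived_span:
  "derived (span B) = derived B"
proof
  let ?D = "derived B"
  have sub: "subspace ?D" by (simp add: derived_def)
  have 1: "br x y \<in> ?D" if "x \<in> B" "y \<in> span B" for x y
    using that(2)
  proof (induction rule: span_induct)
    case base show ?case using sub by (simp add: subspace_def)
  next
    case (step y) then show ?case using that(1) by (auto simp: derived_def intro!: span_base)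
  qed
  have 2: "br x y \<in> ?D" if "x \<in> span B" "y \<in> span B" for x y
    using that(1)
  proof (induction rule: span_induct)
    case base show ?case using sub by (simp add: subspace_def)
  next
    case (step y) then show ?case using that(2) 1 by blast
  qed
  show "derived (span B) \<subseteq> ?D"
    unfolding derived_def[of "span B"] using 2 by (intro span_minimal[OF _ sub]) auto
  show "?D \<subseteq> derived (span B)"
    unfolding derived_def by (intro span_mono) (auto intro: span_base)
qed

lemma derived_subset_span:
  assumes "S \<subseteq> span B"
  shows "derived S \<subseteq> derived B"
proof -
  have "derived S \<subseteq> derived (span B)"
    unfolding derived_def by (intro span_mono) (use assms in auto)
  then show ?thesis by (simp add: derived_span)
qed

lemma derived_ideal:
  assumes "lie_ideal br I"
  shows "lie_ideal br (derived I)" "derived I \<subseteq> I"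
proof -
  have sub: "subspace (derived I)" by (simp add: derived_def)
  have "br x y \<in> derived I" if "y \<in> derived I" for x y
    using that unfolding derived_def
  proof (induction rule: span_induct)
    case base
    show ?case using sub by (simp add: subspace_def derived_def)
  next
    case (step y)
    then obtain u v where uv: "u \<in> I" "v \<in> I" "y = br u v" by auto
    have "br x y = br (br x u) v + br u (br x v)"
      using ad_bracket[of x u v] uv by simp
    moreover have "br (br x u) v \<in> derived I" "br u (br x v) \<in> derived I"
      using uv assms by (auto simp: derived_def lie_ideal_def intro!: span_base)
    ultimately show ?case using sub by (simp add: subspace_add derived_def)
  qed
  with sub show "lie_ideal br (derived I)" by (simp add: lie_ideal_def)
  show "derived I \<subseteq> I"
    using assms unfolding derived_def by (intro span_minimal) (auto simp: lie_ideal_def)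
qed

text \<open>By minimality: the derived ideal of a nonzero ideal of least dimension is zero or everything.\<close>

lemma abelian_or_perfect_ideal:
  assumes "(UNIV::'a set) \<noteq> {0}"
  obtains J where "lie_ideal br J" "J \<noteq> {0}" "derived J = {0} \<or> derived J = J"
proof -
  obtain S :: "'a set" where S: "finite S" "span S = UNIV" by (rule finite_dimensional)
  let ?P = "\<lambda>J. lie_ideal br J \<and> J \<noteq> {0}"
  have "?P UNIV" using assms by (simp add: lie_ideal_def)
  then obtain J where J: "?P J" and min: "\<And>K. ?P K \<Longrightarrow> dim J \<le> dim K"
    using ex_has_least_nat[of ?P UNIV dim] by blast
  have "derived J = J" if "derived J \<noteq> {0}"
  proof (rule ccontr)
    assume "derived J \<noteq> J"
    then have "dim (derived J) < dim J"
      using derived_ideal[of J] J by (intro dim_less_of_psubset[OF S]) (auto simp: lie_ideal_def)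
    then show False using min[of "derived J"] derived_ideal[of J] J that by auto
  qed
  then have "derived J = {0} \<or> derived J = J" by metis
  with that[of J] J show ?thesis by simp
qed

text \<open>The Jacobi identity makes \<open>ad [u, v]\<close> a commutator, and commutators have trace zero.\<close>

lemma trace_ad_derived:
  assumes fr: "dual_frame I b \<beta>" and x: "x \<in> derived S"
  shows "frame_trace I b \<beta> (br x) = 0"
  using x unfolding derived_def
proof (induction rule: span_induct)
  case base
  have *: "linear (\<beta> i)" if "i \<in> I" for i using fr that by (simp add: dual_frame_def)
  show ?case
    unfolding subspace_def frame_trace_def
    by (auto simp: linear_0[OF *] linear_add[OF *] linear_scale[OF *] sum.distrib
        simp flip: sum_distrib_left)
next
  case (step z)
  then obtain u v where z: "z = br u v" by auto
  have *: "linear (\<beta> i)" if "i \<in> I" for i using fr that by (simp add: dual_frame_def)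
  have "frame_trace I b \<beta> (br z)
    = frame_trace I b \<beta> (\<lambda>w. br u (br v w)) - frame_trace I b \<beta> (\<lambda>w. br v (br u w))"
    unfolding z frame_trace_def by (simp add: ad_bracket linear_diff[OF *] sum_subtractf)
  then show ?case using frame_trace_comp[OF fr fr linear_ad linear_ad, of u v] by simp
qed

text \<open>
  Every derivation \<open>D\<close> of a perfect three-dimensional Lie algebra \<open>J\<close> has trace zero. The bracket
  identifies the second exterior power of \<open>J\<close> with \<open>J\<close>, compatibly with \<open>D\<close>, and on the
  exterior power a map of trace \<open>t\<close> on \<open>J\<close> has trace \<open>2 t\<close>. Concretely, the trace comes out as
  \<open>t\<close> in the basis \<open>p1, p2, p3\<close> and as \<open>2 t\<close> in the basis of brackets \<open>F1, F2, F3\<close>. Here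
  \<open>J\<close> is an ideal of codimension one, complemented by \<open>w\<close>, and \<open>D\<close> is inner in the whole algebra;
  since \<open>ad x\<close> maps everything into \<open>J\<close>, the vector \<open>w\<close> contributes nothing to the trace.
\<close>

lemma trace_ad_three_dim:
  assumes J: "lie_ideal br J" "J = span {p1, p2, p3}"
    and B2: "independent {w, p1, p2, p3}" "span {w, p1, p2, p3} = UNIV" "distinct [w, p1, p2, p3]"
    and F: "F1 = br p2 p3" "F2 = br p3 p1" "F3 = br p1 p2"
    and B: "independent {w, F1, F2, F3}" "span {w, F1, F2, F3} = UNIV" "distinct [w, F1, F2, F3]"
    and fr: "dual_frame I b \<beta>"
  shows "frame_trace I b \<beta> (br x) = 0"
proof -
  let ?P = "{w, p1, p2, p3}" and ?F = "{w, F1, F2, F3}"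
  have iJ: "br x y \<in> J" if "y \<in> J" for x y using J that by (simp add: lie_ideal_def)
  have sJ: "subspace J" using J by (simp add: lie_ideal_def)
  have pJ: "p1 \<in> J" "p2 \<in> J" "p3 \<in> J" using J(2) by (auto intro: span_base)
  have FJ: "F1 \<in> J" "F2 \<in> J" "F3 \<in> J" using F iJ pJ by auto
  define a where "a i j = representation ?P (br x j) i" for i j
  have w0: "representation ?P y w = 0" if "y \<in> J" for y
  proof -
    have "representation ?P y = representation {p1, p2, p3} y"
      by (rule representation_extend[OF B2(1)]) (use that J in auto)
    moreover have "representation {p1, p2, p3} y w = 0"
      using representation_ne_zero[of "{p1, p2, p3}" y w] B2(3) by auto
    ultimately show ?thesis by simp
  qed
  have exp: "y = representation ?P y p1 *\<^sub>R p1 + representation ?P y p2 *\<^sub>R p2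
      + representation ?P y p3 *\<^sub>R p3" if "y \<in> J" for y
    using sum_representation_eq[OF B2(1), of y ?P] B2(2,3) w0[OF that] by (simp add: add.assoc)
  have brw: "br x w \<in> J"
  proof -
    have "x = representation ?P x w *\<^sub>R w + (representation ?P x p1 *\<^sub>R p1
        + representation ?P x p2 *\<^sub>R p2 + representation ?P x p3 *\<^sub>R p3)"
      (is "x = _ + ?p")
      using sum_representation_eq[OF B2(1), of x ?P] B2(2,3) by (simp add: add.assoc)
    then have "br x w = br ?p w" by (metis br_simps(1,5) br_self scaleR_zero_right add_0)
    then have "br x w = - br w ?p" using br_skew[of ?p w] by simp
    moreover have "?p \<in> J" unfolding J(2) by (intro span_add span_scale span_base; simp)
    ultimately show ?thesis using subspace_neg[OF sJ iJ] by metis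
  qed
  have w0': "representation ?F y w = 0" if "y \<in> J" for y
  proof -
    have "y \<in> span ?F" using B by simp
    then obtain c where c: "y - c *\<^sub>R w \<in> span {F1, F2, F3}" using span_breakdown_eq by blast
    have sF: "span {F1, F2, F3} \<subseteq> J" using FJ J by (intro span_minimal) (auto simp: lie_ideal_def)
    have "y - (y - c *\<^sub>R w) \<in> J" by (rule subspace_diff[OF sJ that]) (use c sF in blast)
    then have cw: "c *\<^sub>R w \<in> J" by simp
    have "c = 0 \<or> w \<in> J" using subspace_scale[OF sJ cw, of "1 / c"] by (cases "c = 0") auto
    moreover have "w \<notin> J" using B2 J(2) by (simp add: independent_insert)
    ultimately have "y \<in> span {F1, F2, F3}" using c by simp
    then have "representation ?F y = representation {F1, F2, F3} y"
      by (intro representation_extend[OF B(1)]) auto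
    moreover have "representation {F1, F2, F3} y w = 0"
      using representation_ne_zero[of "{F1, F2, F3}" y w] B(3) by auto
    ultimately show ?thesis by simp
  qed
  have e: "br x p = a p1 p *\<^sub>R p1 + a p2 p *\<^sub>R p2 + a p3 p *\<^sub>R p3" if "p \<in> J" for p
    unfolding a_def using exp[OF iJ[OF that]] .
  have sk: "br p2 p1 = - F3" "br p3 p2 = - F1" "br p1 p3 = - F2"
    using br_skew[of p2 p1] br_skew[of p3 p2] br_skew[of p1 p3] F by auto
  have adF: "br x (br u v) = br (br x u) v + br u (br x v)" for u v
    using ad_bracket[of x u v] by simp
  \<comment> \<open>In the basis of brackets, the derivation has the matrix of \<open>t 1 - a\<^sup>T\<close>, where \<open>t\<close> is the
    trace of \<open>a\<close>.\<close>
  have "br x F1 = (a p2 p2 + a p3 p3) *\<^sub>R F1 - a p1 p2 *\<^sub>R F2 - a p1 p3 *\<^sub>R F3"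
    unfolding F(1) adF e[OF pJ(2)] e[OF pJ(3)] using sk F by (simp add: algebra_simps)
  moreover have "br x F2 = (a p1 p1 + a p3 p3) *\<^sub>R F2 - a p2 p1 *\<^sub>R F1 - a p2 p3 *\<^sub>R F3"
    unfolding F(2) adF e[OF pJ(1)] e[OF pJ(3)] using sk F by (simp add: algebra_simps)
  moreover have "br x F3 = (a p1 p1 + a p2 p2) *\<^sub>R F3 - a p3 p1 *\<^sub>R F1 - a p3 p2 *\<^sub>R F2"
    unfolding F(3) adF e[OF pJ(1)] e[OF pJ(2)] using sk F by (simp add: algebra_simps)
  moreover have rep: "representation ?F (r *\<^sub>R u - s *\<^sub>R v - t *\<^sub>R z) y
      = r * representation ?F u y - s * representation ?F v y - t * representation ?F z y" for r s t u v z y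
    using B(1,2) by (simp add: representation_diff representation_scale)
  moreover have ne: "w \<noteq> F1" "w \<noteq> F2" "w \<noteq> F3" "F1 \<noteq> F2" "F1 \<noteq> F3" "F2 \<noteq> F3"
    "F1 \<noteq> w" "F2 \<noteq> w" "F3 \<noteq> w" "F2 \<noteq> F1" "F3 \<noteq> F1" "F3 \<noteq> F2"
    using B(3) by auto
  ultimately have "frame_trace ?F (\<lambda>b. b) (\<lambda>b x. representation ?F x b) (br x)
      = 2 * (a p1 p1 + a p2 p2 + a p3 p3)"
    unfolding frame_trace_def using ne w0'[OF brw]
    by (simp add: representation_basis[OF B(1)])
  moreover have "frame_trace ?P (\<lambda>b. b) (\<lambda>b x. representation ?P x b) (br x)
      = a p1 p1 + a p2 p2 + a p3 p3"
    unfolding frame_trace_def using B2(3) w0[OF brw] by (simp add: a_def)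
  moreover have "frame_trace ?F (\<lambda>b. b) (\<lambda>b x. representation ?F x b) (br x) =
      frame_trace ?P (\<lambda>b. b) (\<lambda>b x. representation ?P x b) (br x)"
    using B B2 linear_ad by (intro frame_trace_unique dual_frame_basis) auto
  moreover have "frame_trace ?P (\<lambda>b. b) (\<lambda>b x. representation ?P x b) (br x) = frame_trace I b \<beta> (br x)"
    using B2 linear_ad fr by (intro frame_trace_unique dual_frame_basis) auto
  ultimately show ?thesis by simp
qed

end

section \<open>Symplectic bases\<close>

locale symplectic_lie = real_lie_algebra br
  for br :: "'a::real_vector \<Rightarrow> 'a \<Rightarrow> 'a" +
  fixes \<omega> :: "'a \<Rightarrow> 'a \<Rightarrow> real"
  assumes symp: "symplectic_lie_algebra br \<omega>"
begin

lemma bilinear_form: "bilinear \<omega>"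
  using symp by (simp add: symplectic_lie_algebra_def)

lemmas form_simps [simp] =
  bilinear_ladd[OF bilinear_form] bilinear_radd[OF bilinear_form]
  bilinear_lsub[OF bilinear_form] bilinear_rsub[OF bilinear_form]
  bilinear_lmul[OF bilinear_form] bilinear_rmul[OF bilinear_form]
  bilinear_lneg[OF bilinear_form] bilinear_rneg[OF bilinear_form]
  bilinear_lzero[OF bilinear_form] bilinear_rzero[OF bilinear_form]

lemma form_skew: "\<omega> x y = - \<omega> y x"
  using symp unfolding symplectic_lie_algebra_def by blast

lemma form_self [simp]: "\<omega> x x = 0"
  using form_skew[of x x] by linarith

lemma form_closed: "\<omega> (br x y) z + \<omega> (br y z) x + \<omega> (br z x) y = 0"
  using symp unfolding symplectic_lie_algebra_def by blast

lemma form_nondegenerate: "(\<And>y. \<omega> x y = 0) \<Longrightarrow> x = 0"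
  using symp unfolding symplectic_lie_algebra_def nondegenerate_form_def by blast

lemma form_linear: "linear (\<omega> x)" "linear (\<lambda>x. \<omega> x y)"
  using bilinear_form by (simp_all add: bilinear_def)

lemma form_sum_left: "\<omega> (\<Sum>i\<in>I. g i) y = (\<Sum>i\<in>I. \<omega> (g i) y)"
  using linear_sum[OF form_linear(2)] by simp

lemma form_sum_right: "\<omega> y (\<Sum>i\<in>I. g i) = (\<Sum>i\<in>I. \<omega> y (g i))"
  using linear_sum[OF form_linear(1)] by simp

definition hyperbolic :: "nat \<Rightarrow> (nat \<Rightarrow> 'a) \<Rightarrow> (nat \<Rightarrow> 'a) \<Rightarrow> bool" where
  "hyperbolic n e f \<longleftrightarrow> (\<forall>i<n. \<forall>j<n. \<omega> (e i) (f j) = (if i = j then 1 else 0)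
     \<and> \<omega> (e i) (e j) = 0 \<and> \<omega> (f i) (f j) = 0)"

text \<open>
  The projection onto the span of the given hyperbolic pairs along their orthogonal complement. The
  pairs are a symplectic basis of a subspace \<open>W\<close> containing them exactly when this projection
  fixes every vector of \<open>W\<close>.
\<close>

definition hyperbolic_part :: "nat \<Rightarrow> (nat \<Rightarrow> 'a) \<Rightarrow> (nat \<Rightarrow> 'a) \<Rightarrow> 'a \<Rightarrow> 'a" where
  "hyperbolic_part n e f x = (\<Sum>i<n. \<omega> x (f i) *\<^sub>R e i + \<omega> (e i) x *\<^sub>R f i)"

text \<open>
  The earlier pairs are orthogonal to \<open>f n\<close>, so their span cannot contain \<open>e n\<close>; likewise, adding
  \<open>e n\<close> gives a span orthogonal to \<open>e n\<close>, which cannot contain \<open>f n\<close>.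
\<close>

lemma hyperbolic_independent:
  assumes "hyperbolic n e f"
  shows "\<exists>B\<subseteq>e ` {..<n} \<union> f ` {..<n}. independent B \<and> finite B \<and> card B = 2 * n"
  using assms
proof (induction n)
  case 0
  show ?case by (rule exI[of _ "{}"]) (simp add: independent_empty)
next
  case (Suc n)
  then have "hyperbolic n e f" by (simp add: hyperbolic_def)
  then obtain B where B: "B \<subseteq> e ` {..<n} \<union> f ` {..<n}" "independent B" "finite B" "card B = 2 * n"
    using Suc.IH by blast
  have ortho: "\<omega> x (f n) = 0" "\<omega> (e n) x = 0" if "x \<in> B" for x
  proof -
    have "x \<in> e ` {..<n} \<union> f ` {..<n}" using B(1) that by blast
    then show "\<omega> x (f n) = 0" "\<omega> (e n) x = 0"
      using Suc.prems unfolding hyperbolic_def by auto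
  qed
  have pair: "\<omega> (e n) (f n) = 1" using Suc.prems by (simp add: hyperbolic_def)
  have en: "e n \<notin> span B"
    using linear_eq_0_on_span[OF form_linear(2)[of "f n"], of B "e n"] ortho pair by auto
  have "\<omega> (e n) x = 0" if "x \<in> insert (e n) B" for x
    using ortho that by auto
  then have fn: "f n \<notin> span (insert (e n) B)"
    using linear_eq_0_on_span[OF form_linear(1)[of "e n"], of "insert (e n) B" "f n"] pair by auto
  have "independent (insert (f n) (insert (e n) B))"
    using en fn B(2) by (simp add: independent_insertI)
  moreover have "card (insert (f n) (insert (e n) B)) = 2 * Suc n"
    using en fn B(3,4) span_base by (metis card_insert_disjoint finite_insert mult_Suc_right add_2_eq_Suc)
  ultimately show ?case
    using B(1,3) by (intro exI[of _ "insert (f n) (insert (e n) B)"] conjI) auto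
qed

lemma hyperbolic_dim:
  assumes "hyperbolic n e f"
  shows "2 * n \<le> dim (UNIV::'a set)"
proof -
  obtain S :: "'a set" where S: "finite S" "span S = UNIV" by (rule finite_dimensional)
  then show ?thesis
    using hyperbolic_independent[OF assms] independent_card_le_dim_UNIV[OF S] by metis
qed

lemma hyperbolic_residual:
  assumes "hyperbolic n e f" "i < n"
  shows "\<omega> (x - hyperbolic_part n e f x) (e i) = 0" "\<omega> (x - hyperbolic_part n e f x) (f i) = 0"
proof -
  have "\<omega> (hyperbolic_part n e f x) (e i) = (\<Sum>j<n. if j = i then \<omega> x (e i) else 0)"
    unfolding hyperbolic_part_def form_sum_left
  proof (intro sum.cong refl)
    fix j assume "j \<in> {..<n}"
    then show "\<omega> (\<omega> x (f j) *\<^sub>R e j + \<omega> (e j) x *\<^sub>R f j) (e i) = (if j = i then \<omega> x (e i) else 0)"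
      using assms form_skew[of "f j" "e i"] form_skew[of "e i" x] by (auto simp: hyperbolic_def)
  qed
  then show "\<omega> (x - hyperbolic_part n e f x) (e i) = 0" using assms(2) by simp
  have "\<omega> (hyperbolic_part n e f x) (f i) = (\<Sum>j<n. if j = i then \<omega> x (f i) else 0)"
    unfolding hyperbolic_part_def form_sum_left
  proof (intro sum.cong refl)
    fix j assume "j \<in> {..<n}"
    then show "\<omega> (\<omega> x (f j) *\<^sub>R e j + \<omega> (e j) x *\<^sub>R f j) (f i) = (if j = i then \<omega> x (f i) else 0)"
      using assms by (auto simp: hyperbolic_def)
  qed
  then show "\<omega> (x - hyperbolic_part n e f x) (f i) = 0" using assms(2) by simp
qed

lemma hyperbolic_part_in:
  assumes "subspace W" "\<And>i. i < n \<Longrightarrow> e i \<in> W \<and> f i \<in> W"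
  shows "hyperbolic_part n e f x \<in> W"
  unfolding hyperbolic_part_def using assms
  by (intro subspace_sum) (auto intro!: subspace_add subspace_scale)

text \<open>
  The symplectic Gram--Schmidt process. A vector of \<open>W\<close> outside the span of the current pairs has a
  nonzero residual orthogonal to them, and nondegeneracy on \<open>W\<close> supplies a partner for it. The
  bound on the number of pairs by the dimension makes the process stop.
\<close>

lemma hyperbolic_extend:
  assumes W: "subspace W" and nondeg: "\<And>x. x \<in> W \<Longrightarrow> (\<And>y. y \<in> W \<Longrightarrow> \<omega> x y = 0) \<Longrightarrow> x = 0"
    and "hyperbolic m e f" "\<And>i. i < m \<Longrightarrow> e i \<in> W \<and> f i \<in> W"
  shows "\<exists>n e' f'. m \<le> n \<and> hyperbolic n e' f' \<and> (\<forall>i<m. e' i = e i \<and> f' i = f i) \<and>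
           (\<forall>i<n. e' i \<in> W \<and> f' i \<in> W) \<and> (\<forall>x\<in>W. hyperbolic_part n e' f' x = x)"
  using assms(3,4)
proof (induction "dim (UNIV::'a set) - 2 * m" arbitrary: m e f rule: less_induct)
  case less
  show ?case
  proof (cases "\<forall>x\<in>W. hyperbolic_part m e f x = x")
    case True
    then show ?thesis using less.prems by blast
  next
    case False
    then obtain x where x: "x \<in> W" "hyperbolic_part m e f x \<noteq> x" by blast
    define r where "r = x - hyperbolic_part m e f x"
    have r: "r \<in> W" "r \<noteq> 0"
      using x hyperbolic_part_in[OF W] less.prems(2) W by (auto simp: r_def intro: subspace_diff)
    have ro: "\<omega> r (e i) = 0" "\<omega> r (f i) = 0" if "i < m" for i
      using hyperbolic_residual[OF less.prems(1) that] by (simp_all add: r_def)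
    obtain y where y: "y \<in> W" "\<omega> r y \<noteq> 0" using nondeg r by blast
    define s where "s = (1 / \<omega> r y) *\<^sub>R (y - hyperbolic_part m e f y)"
    have s: "s \<in> W"
      using y hyperbolic_part_in[OF W] less.prems(2) W by (auto simp: s_def intro!: subspace_diff subspace_scale)
    have so: "\<omega> s (e i) = 0" "\<omega> s (f i) = 0" if "i < m" for i
      using hyperbolic_residual[OF less.prems(1) that, of y] by (simp_all add: s_def del: form_simps(3))
    have "\<omega> r (hyperbolic_part m e f y) = 0"
      unfolding hyperbolic_part_def form_sum_right using ro by (simp add: sum.neutral)
    then have rs: "\<omega> r s = 1" using y by (simp add: s_def)
    let ?e = "e(m := r)" and ?f = "f(m := s)"
    have ro': "\<omega> (e i) r = 0" "\<omega> (f i) r = 0" "\<omega> (e i) s = 0" "\<omega> (f i) s = 0" if "i < m" for i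
      using form_skew[of "e i" r] form_skew[of "f i" r] form_skew[of "e i" s] form_skew[of "f i" s]
        ro[OF that] so[OF that] by linarith+
    have hyp: "hyperbolic (Suc m) ?e ?f"
      unfolding hyperbolic_def
    proof (intro allI impI)
      fix i j assume "i < Suc m" "j < Suc m"
      then consider "i < m" "j < m" | "i < m" "j = m" | "i = m" "j < m" | "i = m" "j = m" by linarith
      then show "\<omega> (?e i) (?f j) = (if i = j then 1 else 0) \<and> \<omega> (?e i) (?e j) = 0 \<and> \<omega> (?f i) (?f j) = 0"
      proof cases
        case 1
        then show ?thesis using less.prems(1) by (simp add: hyperbolic_def)
      qed (simp_all add: ro ro' so rs)
    qed
    have inW: "?e i \<in> W \<and> ?f i \<in> W" if "i < Suc m" for i
      using that less.prems(2)[of i] r s by (cases "i = m") auto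
    have "dim (UNIV::'a set) - 2 * Suc m < dim (UNIV::'a set) - 2 * m"
      using hyperbolic_dim[OF hyp] by simp
    from less.hyps[OF this hyp inW] obtain n e' f' where n: "Suc m \<le> n" "hyperbolic n e' f'"
      "\<forall>i<Suc m. e' i = ?e i \<and> f' i = ?f i" "\<forall>i<n. e' i \<in> W \<and> f' i \<in> W"
      "\<forall>x\<in>W. hyperbolic_part n e' f' x = x" by blast
    have "\<forall>i<m. e' i = e i \<and> f' i = f i"
      using n(3) by auto
    with n show ?thesis by (meson Suc_leD)
  qed
qed

lemma symplectic_basis_exists:
  assumes W: "subspace W" and nondeg: "\<And>x. x \<in> W \<Longrightarrow> (\<And>y. y \<in> W \<Longrightarrow> \<omega> x y = 0) \<Longrightarrow> x = 0"
  obtains n e f where "hyperbolic n e f" "\<And>i. i < n \<Longrightarrow> e i \<in> W \<and> f i \<in> W"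
    "\<And>x. x \<in> W \<Longrightarrow> hyperbolic_part n e f x = x"
proof -
  have "hyperbolic 0 (\<lambda>i. 0) (\<lambda>i. 0)" by (simp add: hyperbolic_def)
  from hyperbolic_extend[OF W nondeg this] show ?thesis
    using that by auto
qed

lemma symplectic_basis_frame:
  assumes "\<And>x. hyperbolic_part n e f x = x"
  shows "dual_frame ({..<n} \<times> UNIV) (\<lambda>(i, b). if b then e i else f i)
           (\<lambda>(i, b) x. if b then \<omega> x (f i) else \<omega> (e i) x)"
  unfolding dual_frame_def
proof (intro conjI ballI allI)
  fix p :: "nat \<times> bool"
  show "linear ((\<lambda>(i, b) x. if b then \<omega> x (f i) else \<omega> (e i) x) p)"
    using form_linear by (cases p; cases "snd p") auto
next
  fix x
  have "(\<Sum>p\<in>{..<n} \<times> UNIV. (\<lambda>(i, b) x. if b then \<omega> x (f i) else \<omega> (e i) x) p x *\<^sub>R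
          (\<lambda>(i, b). if b then e i else f i) p) = hyperbolic_part n e f x"
    unfolding hyperbolic_part_def
    by (simp add: UNIV_bool sum.cartesian_product' add.commute)
  then show "(\<Sum>p\<in>{..<n} \<times> UNIV. (\<lambda>(i, b) x. if b then \<omega> x (f i) else \<omega> (e i) x) p x *\<^sub>R
          (\<lambda>(i, b). if b then e i else f i) p) = x" using assms by simp
qed simp

section \<open>Exact symplectic forms and abelian ideals\<close>

text \<open>
  If \<open>\<alpha> = \<omega> v\<close>, closedness turns exactness into
  \<open>\<omega> [v, x] y + \<omega> x [v, y] = \<omega> x y\<close>. In a symplectic basis \<open>e, f\<close> of \<open>n\<close> pairs the trace
  of \<open>ad v\<close> is the sum of the left-hand sides for \<open>x = e i\<close>, \<open>y = f i\<close>, hence equals \<open>n\<close>.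
\<close>

lemma exact_not_unimodular:
  assumes \<alpha>: "linear \<alpha>" "\<And>x y. \<omega> x y = \<alpha> (br x y)"
    and fr: "dual_frame I b \<beta>" and tr: "\<And>x. frame_trace I b \<beta> (br x) = 0"
  shows "(UNIV::'a set) = {0}"
proof -
  obtain n e f where hyp: "hyperbolic n e f" and part: "\<And>x. hyperbolic_part n e f x = x"
    using symplectic_basis_exists[OF subspace_UNIV] form_nondegenerate by (metis UNIV_I)
  define v where "v = (\<Sum>i<n. \<alpha> (f i) *\<^sub>R e i - \<alpha> (e i) *\<^sub>R f i)"
  have v: "\<omega> v y = \<alpha> y" for y
  proof -
    have "\<alpha> y = \<alpha> (hyperbolic_part n e f y)" by (simp add: part)
    also have "\<dots> = (\<Sum>i<n. \<omega> y (f i) * \<alpha> (e i) + \<omega> (e i) y * \<alpha> (f i))"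
      unfolding hyperbolic_part_def
      by (simp add: linear_sum[OF \<alpha>(1)] linear_add[OF \<alpha>(1)] linear_scale[OF \<alpha>(1)])
    also have "\<dots> = \<omega> v y"
      unfolding v_def form_sum_left
    proof (intro sum.cong refl)
      fix i
      show "\<omega> y (f i) * \<alpha> (e i) + \<omega> (e i) y * \<alpha> (f i) = \<omega> (\<alpha> (f i) *\<^sub>R e i - \<alpha> (e i) *\<^sub>R f i) y"
        using form_skew[of y "f i"] by simp
    qed
    finally show ?thesis by simp
  qed
  have euler: "\<omega> (br v x) y + \<omega> x (br v y) = \<omega> x y" for x y
  proof -
    have "\<omega> (br v x) y + \<omega> x (br v y) = \<omega> (br v x) y + \<omega> (br y v) x"
      using form_skew[of x "br v y"] br_skew[of y v] by simp
    also have "\<dots> = \<omega> v (br x y)"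
      using form_closed[of v x y] form_skew[of "br x y" v] by linarith
    finally show ?thesis using v[of "br x y"] \<alpha>(2)[of x y] by linarith
  qed
  have "0 = frame_trace ({..<n} \<times> UNIV) (\<lambda>(i, b). if b then e i else f i)
           (\<lambda>(i, b) x. if b then \<omega> x (f i) else \<omega> (e i) x) (br v)"
    using frame_trace_unique[OF fr symplectic_basis_frame[OF part] linear_ad] tr by simp
  also have "\<dots> = (\<Sum>i<n. \<omega> (br v (e i)) (f i) + \<omega> (e i) (br v (f i)))"
    unfolding frame_trace_def
    by (simp add: sum.cartesian_product' UNIV_bool add.commute)
  also have "\<dots> = real n"
    using hyp by (simp add: euler hyperbolic_def)
  finally have "n = 0" by simp
  then have "x = 0" for x :: 'a using part[of x] by (simp add: hyperbolic_part_def)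
  then show ?thesis by auto
qed

text \<open>
  For \<open>y\<close> in the radical and \<open>z\<close> in \<open>J\<close>, closedness expresses \<open>\<omega> [x, y] z\<close> through
  \<open>[y, z]\<close>, which vanishes, and \<open>[z, x]\<close>, which lies in \<open>J\<close> and is therefore orthogonal to \<open>y\<close>.
\<close>

lemma abelian_ideal_radical:
  assumes J: "lie_ideal br J" and ab: "\<And>x y. x \<in> J \<Longrightarrow> y \<in> J \<Longrightarrow> br x y = 0"
  defines "R \<equiv> {x \<in> J. \<forall>y\<in>J. \<omega> x y = 0}"
  shows "lie_ideal br R" "isotropic \<omega> R"
proof -
  have sJ: "subspace J" and iJ: "\<And>x y. y \<in> J \<Longrightarrow> br x y \<in> J" using J by (auto simp: lie_ideal_def)
  have sub: "subspace R"
    using sJ by (auto simp: R_def subspace_def)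
  have "br x y \<in> R" if y: "y \<in> R" for x y
  proof -
    have yJ: "y \<in> J" using y by (simp add: R_def)
    have "\<omega> (br x y) z = 0" if z: "z \<in> J" for z
    proof -
      have "br y z = 0" using ab yJ z .
      moreover have "\<omega> (br z x) y = 0"
        using y iJ[OF z, of x] br_skew[of z x] form_skew[of "br x z" y] by (auto simp: R_def)
      ultimately show ?thesis using form_closed[of x y z] by simp
    qed
    then show ?thesis using iJ[OF yJ] by (simp add: R_def)
  qed
  then show "lie_ideal br R" using sub by (simp add: lie_ideal_def)
  show "isotropic \<omega> R" using sub by (auto simp: isotropic_def R_def)
qed

end

section \<open>Symplectically irreducible algebras of small dimension\<close>

locale small_irreducible = symplectic_lie +
  assumes irred: "symplectically_irreducible br \<omega>"
    and dim_less_6: "dim (UNIV::'a set) < 6"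
begin

text \<open>A common eigenvector of all inner derivations spans an ideal, and every line is isotropic.\<close>

lemma no_ideal_line:
  assumes "span B = UNIV" "\<And>b. b \<in> B \<Longrightarrow> br b u \<in> span {u}"
  shows "u = 0"
proof -
  have "br x u \<in> span {u}" for x
  proof -
    have "x \<in> span B" using assms(1) by simp
    then show ?thesis
    proof (induction rule: span_induct)
      case base show ?case
        by (auto simp: subspace_def intro: span_zero span_add span_scale)
    qed (use assms(2) in auto)
  qed
  then have "br x y \<in> span {u}" if y: "y \<in> span {u}" for x y
  proof -
    obtain k where "y = k *\<^sub>R u" using y by (auto simp: span_singleton)
    then show ?thesis using span_scale[OF \<open>\<And>x. br x u \<in> span {u}\<close>, of k] by simp
  qed
  then have "lie_ideal br (span {u})" by (simp add: lie_ideal_def)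
  moreover have "isotropic \<omega> (span {u})"
    unfolding isotropic_def by (intro conjI subspace_span) (auto simp: span_singleton)
  ultimately have "span {u} = {0}" using irred by (auto simp: symplectically_irreducible_def)
  then show ?thesis using span_base[of u "{u}"] by simp
qed

lemma abelian_ideal_nondegenerate:
  assumes "lie_ideal br J" "\<And>x y. x \<in> J \<Longrightarrow> y \<in> J \<Longrightarrow> br x y = 0"
    and "x \<in> J" "\<And>y. y \<in> J \<Longrightarrow> \<omega> x y = 0"
  shows "x = 0"
proof -
  let ?R = "{x \<in> J. \<forall>y\<in>J. \<omega> x y = 0}"
  have "?R = {0}"
    using abelian_ideal_radical[OF assms(1,2)] irred unfolding symplectically_irreducible_def by blast
  moreover have "x \<in> ?R" using assms by auto
  ultimately show ?thesis by blast
qed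

lemma hyperbolic_le_2: "hyperbolic n e f \<Longrightarrow> n \<le> 2"
  using hyperbolic_dim[of n e f] dim_less_6 by linarith

lemma hyperbolic_part_2:
  "hyperbolic_part 2 e f x = \<omega> x (f 0) *\<^sub>R e 0 + \<omega> (e 0) x *\<^sub>R f 0 + \<omega> x (f 1) *\<^sub>R e 1 + \<omega> (e 1) x *\<^sub>R f 1"
  by (simp add: hyperbolic_part_def numeral_2_eq_2 algebra_simps)

lemma scaled_in_span: "c *\<^sub>R u \<in> span {u}"
  by (simp add: span_base span_scale)

section \<open>Nonzero abelian ideals do not exist\<close>

text \<open>
  Here \<open>e, f\<close> span an abelian ideal and \<open>x, y\<close> a complementary subalgebra, acting by the traceless
  matrices \<open>X\<close> and \<open>Y\<close> with entries \<open>p, q, r\<close> and \<open>s, t, v\<close>. As \<open>[X, Y] = l X\<close>, there are two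
  cases. If \<open>l = 0\<close>, commuting elements of \<open>sl(2)\<close> are proportional, so some nonzero combination of
  \<open>x\<close> and \<open>y\<close> acts trivially and is central. If \<open>l \<noteq> 0\<close>, then \<open>X\<close> is nilpotent: either it is
  zero and \<open>x\<close> spans an ideal, or its kernel is a line in the plane, preserved by \<open>Y\<close> as well.
\<close>

lemma plane_action_impossible:
  assumes sp: "span {e, f, x, y} = UNIV"
    and ef: "\<And>c d. c *\<^sub>R e + d *\<^sub>R f = 0 \<Longrightarrow> c = 0 \<and> d = 0"
    and xy: "\<And>c d. c *\<^sub>R x + d *\<^sub>R y = 0 \<Longrightarrow> c = 0 \<and> d = 0"
    and [simp]: "br e f = 0" "br x e = p *\<^sub>R e + q *\<^sub>R f" "br x f = r *\<^sub>R e - p *\<^sub>R f"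
      "br y e = s *\<^sub>R e + t *\<^sub>R f" "br y f = v *\<^sub>R e - s *\<^sub>R f" "br x y = l *\<^sub>R x"
  shows False
proof -
  have [simp]: "br f e = 0" "br e x = - br x e" "br f x = - br x f"
    "br e y = - br y e" "br f y = - br y f" "br y x = - (l *\<^sub>R x)"
    using br_skew[of f e] br_skew[of e x] br_skew[of f x] br_skew[of e y] br_skew[of f y] br_skew[of y x]
    by simp_all
  have twice: "(g * (h * 2)) *\<^sub>R w = (g * h) *\<^sub>R w + (g * h) *\<^sub>R w" for g h and w :: 'a
    by (simp flip: scaleR_add_left)
  have "(t * r - q * v - l * p) *\<^sub>R e + ((s * q - t * p) + (s * q - t * p) - l * q) *\<^sub>R f = 0"
    using ad_bracket[of x y e] by (simp add: algebra_simps twice)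
  from ef[OF this] have E1: "t * r - q * v = l * p" and E2: "2 * (s * q - t * p) = l * q"
    by (auto simp: algebra_simps)
  have "((v * p - s * r) + (v * p - s * r) - l * r) *\<^sub>R e + (v * q - r * t + l * p) *\<^sub>R f = 0"
    using ad_bracket[of x y f] by (simp add: algebra_simps twice)
  from ef[OF this] have E3: "2 * (v * p - s * r) = l * r"
    by (auto simp: algebra_simps)
  show False
  proof (cases "l = 0")
    case True
    \<comment> \<open>The vectors \<open>(p, q, r)\<close> and \<open>(s, t, v)\<close> have zero cross product.\<close>
    obtain c d where cd: "c \<noteq> 0 \<or> d \<noteq> 0"
      "c * p + d * s = 0" "c * q + d * t = 0" "c * r + d * v = 0"
    proof -
      consider "s \<noteq> 0 \<or> p \<noteq> 0" | "s = 0" "p = 0" "t \<noteq> 0 \<or> q \<noteq> 0" | "s = 0" "p = 0" "t = 0" "q = 0"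
        by blast
      then show thesis
      proof cases
        case 1
        show thesis using that[of s "-p"] 1 E1 E2 E3 True by (auto simp: algebra_simps)
      next
        case 2
        show thesis using that[of t "-q"] 2 E1 E2 E3 True by (auto simp: algebra_simps)
      next
        case 3
        show thesis using that[of v "-r"] that[of 1 0] 3 by (cases "v = 0 \<and> r = 0") (auto simp: algebra_simps)
      qed
    qed
    define u where "u = c *\<^sub>R x + d *\<^sub>R y"
    have "br e u = - ((c * p + d * s) *\<^sub>R e + (c * q + d * t) *\<^sub>R f)"
      "br f u = - ((c * r + d * v) *\<^sub>R e - (c * p + d * s) *\<^sub>R f)"
      by (simp_all add: u_def algebra_simps)
    then have "br b u \<in> span {u}" if "b \<in> {e, f, x, y}" for b
      using that cd True by (auto simp: span_zero) (simp_all add: u_def span_zero)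
    then have "u = 0" using no_ideal_line[OF sp] by blast
    then show False using xy cd unfolding u_def by blast
  next
    case False
    \<comment> \<open>The determinant form is invariant, so \<open>[X, Y]\<close> is orthogonal to \<open>X\<close> for it.\<close>
    have "l * (p * p + q * r) = 0"
      using E1 E2 E3 by algebra
    then have Q: "p * p + q * r = 0" using False by simp
    consider "p = 0" "q = 0" "r = 0" | "p = 0" "q = 0" "r \<noteq> 0" | "q \<noteq> 0" | "p \<noteq> 0" "q = 0" by blast
    then show False
    proof cases
      case 1
      then have "br b x \<in> span {x}" if "b \<in> {e, f, x, y}" for b
        using that scaled_in_span[of "-l" x] by (auto simp: span_zero)
      then have "x = 0" using no_ideal_line[OF sp] by blast
      then show False using xy[of 1 0] by simp
    next
      case 2
      then have "t = 0" using E1 by simp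
      then have "br b e \<in> span {e}" if "b \<in> {e, f, x, y}" for b
        using that 2 scaled_in_span[of s e] by (auto simp: span_zero)
      then have "e = 0" using no_ideal_line[OF sp] by blast
      then show False using ef[of 1 0] by simp
    next
      case 3
      \<comment> \<open>The kernel of \<open>X\<close> is its image, spanned by \<open>X e\<close>; \<open>k\<close> is the eigenvalue of \<open>Y\<close> there.\<close>
      define u where "u = p *\<^sub>R e + q *\<^sub>R f"
      define k where "k = (p * t - q * s) / q"
      have "q * (q * v + t * r + 2 * p * s) = 0"
        using E1 E2 Q by algebra
      then have "q * v + t * r + 2 * p * s = 0" using 3 by simp
      then have "(p * s + q * v) * q = p * (p * t - q * s)" using Q by algebra
      then have k: "p * s + q * v = k * p" "p * t - q * s = k * q"
        using 3 by (simp_all add: k_def field_simps)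
      have "br y u = (p * s + q * v) *\<^sub>R e + (p * t - q * s) *\<^sub>R f"
        by (simp add: u_def algebra_simps)
      then have "br y u = k *\<^sub>R u" unfolding k by (simp add: u_def scaleR_add_right)
      moreover have "br x u = (p * p + q * r) *\<^sub>R e" by (simp add: u_def algebra_simps)
      moreover have "br e u = 0" "br f u = 0" by (simp_all add: u_def)
      ultimately have "br b u \<in> span {u}" if "b \<in> {e, f, x, y}" for b
        using that Q scaled_in_span[of k u] by (auto simp: span_zero)
      then have "u = 0" using no_ideal_line[OF sp] by blast
      then show False using ef 3 unfolding u_def by blast
    qed (use Q in auto)
  qed
qed

text \<open>
  A symplectic basis of \<open>J\<close> extends to one of the whole algebra, which has at most two pairs; since
  \<open>J\<close> is neither zero nor everything, it is spanned by the first of exactly two pairs.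
\<close>

lemma abelian_ideal_zero:
  assumes J: "lie_ideal br J" and ab: "\<And>x y. x \<in> J \<Longrightarrow> y \<in> J \<Longrightarrow> br x y = 0"
  shows "J = {0}"
proof (rule ccontr)
  assume "J \<noteq> {0}"
  have sJ: "subspace J" and iJ: "\<And>x y. y \<in> J \<Longrightarrow> br x y \<in> J" using J by (auto simp: lie_ideal_def)
  have nd: "x = 0" if "x \<in> J" "\<And>y. y \<in> J \<Longrightarrow> \<omega> x y = 0" for x
    using abelian_ideal_nondegenerate[OF J ab that] .
  have J_ne: "J \<noteq> UNIV"
  proof
    assume "J = UNIV"
    then have "u = 0" for u :: 'a
      using no_ideal_line[of UNIV u] ab by (simp add: span_zero)
    then show False using \<open>J \<noteq> {0}\<close> \<open>J = UNIV\<close> by auto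
  qed
  obtain m e0 f0 where m: "hyperbolic m e0 f0" and inJ: "\<And>i. i < m \<Longrightarrow> e0 i \<in> J \<and> f0 i \<in> J"
    and partJ: "\<And>x. x \<in> J \<Longrightarrow> hyperbolic_part m e0 f0 x = x"
    using symplectic_basis_exists[OF sJ nd] by metis
  obtain n e f where n: "m \<le> n" "hyperbolic n e f" and ext: "\<And>i. i < m \<Longrightarrow> e i = e0 i \<and> f i = f0 i"
    and part: "\<And>x. hyperbolic_part n e f x = x"
    using hyperbolic_extend[OF subspace_UNIV _ m] form_nondegenerate by (metis UNIV_I)
  have "m \<noteq> n"
  proof
    assume "m = n"
    have "x \<in> J" for x
      using part[of x] hyperbolic_part_in[OF sJ, of n e f x] inJ ext \<open>m = n\<close> by metis
    then show False using J_ne by blast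
  qed
  moreover have "m \<noteq> 0"
  proof
    assume "m = 0"
    then have "x = 0" if "x \<in> J" for x using partJ[OF that] by (simp add: hyperbolic_part_def)
    then show False using \<open>J \<noteq> {0}\<close> subspace_0[OF sJ] by blast
  qed
  ultimately have mn: "m = 1" "n = 2" using n hyperbolic_le_2[OF n(2)] by auto
  define E F X Y where "E = e 0" "F = f 0" "X = e 1" "Y = f 1"
  have EFJ: "E \<in> J" "F \<in> J" using inJ[of 0] ext[of 0] mn by (simp_all add: E_F_X_Y_def)
  have pair: "\<omega> E F = 1" "\<omega> X Y = 1" "\<omega> E X = 0" "\<omega> E Y = 0" "\<omega> X F = 0" "\<omega> F Y = 0"
    "\<omega> F X = 0" "\<omega> X E = 0" "\<omega> Y E = 0" "\<omega> Y F = 0" "\<omega> F E = -1" "\<omega> Y X = -1"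
    using n(2) mn form_skew[of F E] form_skew[of Y E] form_skew[of Y F] form_skew[of Y X]
      form_skew[of F X]
    by (auto simp: hyperbolic_def E_F_X_Y_def)
  have expand: "x = \<omega> x F *\<^sub>R E + \<omega> E x *\<^sub>R F + \<omega> x Y *\<^sub>R X + \<omega> X x *\<^sub>R Y" for x
    using part[of x] mn by (simp add: hyperbolic_part_2 E_F_X_Y_def)
  have J_expand: "x = \<omega> x F *\<^sub>R E + \<omega> E x *\<^sub>R F" if "x \<in> J" for x
    using partJ[OF that] mn ext[of 0] by (simp add: hyperbolic_part_def E_F_X_Y_def)
  have sp: "span {E, F, X, Y} = UNIV"
  proof -
    have "x \<in> span {E, F, X, Y}" for x
      by (subst expand[of x]) (intro span_add span_scale span_base; simp)
    then show ?thesis by blast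
  qed
  \<comment> \<open>Since \<open>[E, F] = 0\<close>, closedness says that \<open>ad z\<close> is infinitesimally symplectic on \<open>J\<close>.\<close>
  have ad_sp: "\<omega> E (br z F) = - \<omega> (br z E) F" for z
    using form_closed[of z E F] ab[OF EFJ] br_skew[of F z] form_skew[of "br z F" E] by simp
  have "br E F = 0" using ab EFJ by blast
  \<comment> \<open>The orthogonal complement of an ideal is a subalgebra.\<close>
  have XY: "br X Y = \<omega> (br X Y) Y *\<^sub>R X + \<omega> X (br X Y) *\<^sub>R Y"
  proof -
    have "\<omega> (br z w) u = 0" if "u \<in> J" "z \<in> {X, Y}" "w \<in> {X, Y}" for z w u
    proof -
      have "\<omega> a b = 0" if "a \<in> J" "b \<in> {X, Y}" for a b
        by (subst J_expand[OF that(1)]) (use that(2) pair in auto)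
      then have "\<omega> (br w u) z = 0" "\<omega> (br z u) w = 0" using iJ that by blast+
      then show ?thesis using form_closed[of z w u] br_skew[of u z] by simp
    qed
    then have "\<omega> (br X Y) F = 0" "\<omega> (br X Y) E = 0" using EFJ by auto
    then show ?thesis using expand[of "br X Y"] form_skew[of E "br X Y"] by simp
  qed
  define a b where "a = \<omega> (br X Y) Y" "b = \<omega> X (br X Y)"
  have XY': "br X Y = a *\<^sub>R X + b *\<^sub>R Y" using XY by (simp add: a_b_def)
  \<comment> \<open>The given \<open>X, Y\<close> need not satisfy \<open>[X, Y] = l X\<close>, so the complement may have to be given
    another basis \<open>x, y\<close>, whose first vector spans its derived algebra.\<close>
  have core: False
    if x: "x = c1 *\<^sub>R X + c2 *\<^sub>R Y" and y: "y = d1 *\<^sub>R X + d2 *\<^sub>R Y" and det: "c1 * d2 - c2 * d1 \<noteq> 0"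
      and xy: "br x y = l *\<^sub>R x" for x y c1 c2 d1 d2 l
  proof -
    have [simp]: "\<omega> x Y = c1" "\<omega> X x = c2" "\<omega> y Y = d1" "\<omega> X y = d2" using x y pair by simp_all
    have i1: "c = 0 \<and> d = 0" if "c *\<^sub>R E + d *\<^sub>R F = 0" for c d
      using arg_cong[OF that, of "\<omega> E"] arg_cong[OF that, of "\<omega> F"] pair by simp
    have i2: "c = 0 \<and> d = 0" if "c *\<^sub>R x + d *\<^sub>R y = 0" for c d
    proof -
      have "c * c1 + d * d1 = 0" "c * c2 + d * d2 = 0"
        using arg_cong[OF that, of "\<lambda>z. \<omega> z Y"] arg_cong[OF that, of "\<omega> X"] by simp_all
      then have "c * (c1 * d2 - c2 * d1) = 0" "d * (c1 * d2 - c2 * d1) = 0" by algebra+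
      then show ?thesis using det by simp
    qed
    have sp': "span {E, F, x, y} = UNIV"
    proof -
      have "X = (1 / (c1 * d2 - c2 * d1)) *\<^sub>R (d2 *\<^sub>R x - c2 *\<^sub>R y)"
      proof -
        have "d2 *\<^sub>R x - c2 *\<^sub>R y = (c1 * d2 - c2 * d1) *\<^sub>R X" unfolding x y by (simp add: algebra_simps)
        then show ?thesis using det by simp
      qed
      moreover have "Y = (1 / (c1 * d2 - c2 * d1)) *\<^sub>R (c1 *\<^sub>R y - d1 *\<^sub>R x)"
      proof -
        have "c1 *\<^sub>R y - d1 *\<^sub>R x = (c1 * d2 - c2 * d1) *\<^sub>R Y" unfolding x y by (simp add: algebra_simps)
        then show ?thesis using det by simp
      qed
      moreover have "g *\<^sub>R (h *\<^sub>R x - k *\<^sub>R y) \<in> span {E, F, x, y}"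
        "g *\<^sub>R (h *\<^sub>R y - k *\<^sub>R x) \<in> span {E, F, x, y}" for g h k
        by (intro span_scale span_diff span_base; simp)+
      ultimately have "{E, F, X, Y} \<subseteq> span {E, F, x, y}"
        using span_superset[of "{E, F, x, y}"] by (metis insert_subset empty_subsetI)
      then show ?thesis using sp span_mono span_span by (metis top.extremum_unique)
    qed
    have E: "br z E = \<omega> (br z E) F *\<^sub>R E + \<omega> E (br z E) *\<^sub>R F"
      and F: "br z F = \<omega> (br z F) F *\<^sub>R E - \<omega> (br z E) F *\<^sub>R F" for z
      using J_expand[OF iJ[OF EFJ(1)]] J_expand[OF iJ[OF EFJ(2)], of z] ad_sp[of z] by auto
    show False
      by (rule plane_action_impossible[OF sp' i1 i2 \<open>br E F = 0\<close> E F E F xy])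
  qed
  show False
  proof (cases "a = 0")
    case True
    show False
    proof (cases "b = 0")
      case True
      then show False using core[of X 1 0 Y 0 1 0] \<open>a = 0\<close> XY' by simp
    next
      case False
      show False using core[of "b *\<^sub>R Y" 0 b "(-1 / b) *\<^sub>R X" "-1 / b" 0 1] XY' True False br_skew[of Y X] by simp
    qed
  next
    case False
    show False using core[of "a *\<^sub>R X + b *\<^sub>R Y" a b "(1 / a) *\<^sub>R Y" 0 "1 / a" 1] XY' False by simp
  qed
qed

section \<open>Nonzero perfect ideals do not exist\<close>

lemma symplectic_basis_4:
  assumes "2 < dim (UNIV::'a set)"
  obtains e f where "hyperbolic 2 e f" "\<And>x. hyperbolic_part 2 e f x = x" "dim (UNIV::'a set) = 4"
proof -
  obtain n e f where hyp: "hyperbolic n e f" and part: "\<And>x. hyperbolic_part n e f x = x"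
    using symplectic_basis_exists[OF subspace_UNIV] form_nondegenerate by (metis UNIV_I)
  let ?B = "e ` {..<n} \<union> f ` {..<n}"
  have "x \<in> span ?B" for x
    using hyperbolic_part_in[OF subspace_span, of n e ?B f x] part[of x] by (auto intro: span_base)
  then have "dim (UNIV::'a set) \<le> card ?B" by (intro dim_le_card) auto
  also have "\<dots> \<le> 2 * n"
    using card_Un_le[of "e ` {..<n}" "f ` {..<n}"] card_image_le[of "{..<n}" e] card_image_le[of "{..<n}" f]
    by simp
  finally have le: "dim (UNIV::'a set) \<le> 2 * n" .
  then have n: "n = 2" using assms hyperbolic_le_2[OF hyp] by linarith
  then have "dim (UNIV::'a set) = 4" using le hyperbolic_dim[OF hyp] by simp
  then show thesis using that hyp part n by blast
qed

text \<open>
  Suppose a four-dimensional algebra with basis \<open>e1, e2, e3, e4\<close> is perfect; then it is unimodular.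
  For a functional \<open>\<alpha>\<close> the entries \<open>\<alpha> [e i, e j]\<close> form a skew matrix \<open>M\<close>. The space of skew
  matrices has dimension 6 and splits into self-dual and anti-self-dual ones, of dimension 3 each, so
  three linear conditions on \<open>\<alpha>\<close> make \<open>M\<close> self-dual, and a nonzero \<open>\<alpha>\<close> satisfies them. A
  self-dual \<open>M\<close> with first row \<open>0, a, b, c\<close> has square \<open>- (a\<^sup>2 + b\<^sup>2 + c\<^sup>2) 1\<close>, so it is
  invertible unless \<open>\<alpha>\<close> kills all brackets, which perfectness rules out. Thus \<open>\<alpha>\<close> yields an exact
  symplectic form on a unimodular algebra.
\<close>

lemma not_perfect:
  assumes dim: "2 < dim (UNIV::'a set)"
  shows "derived UNIV \<noteq> UNIV"
proof
  assume perf: "derived UNIV = UNIV"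
  obtain e f where hyp: "hyperbolic 2 e f" and part: "\<And>x. hyperbolic_part 2 e f x = x"
    and dim4: "dim (UNIV::'a set) = 4"
    using symplectic_basis_4[OF dim] by blast
  define e1 e2 e3 e4 where e_defs: "e1 = e 0" "e2 = f 0" "e3 = e 1" "e4 = f 1"
  have expand: "\<exists>x1 x2 x3 x4. x = x1 *\<^sub>R e1 + x2 *\<^sub>R e2 + x3 *\<^sub>R e3 + x4 *\<^sub>R e4" for x
    using part[of x] unfolding hyperbolic_part_2 e_defs by metis
  \<comment> \<open>The functionals that vanish on these three vectors are those with a self-dual matrix.\<close>
  let ?U = "{br e1 e2 - br e3 e4, br e1 e3 + br e2 e4, br e1 e4 - br e2 e3}"
  have "span ?U \<noteq> UNIV"
  proof
    assume "span ?U = UNIV"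
    then have "dim (UNIV::'a set) \<le> card ?U" by (intro dim_le_card) auto
    also have "\<dots> \<le> 3" by (simp add: card_insert_if)
    finally show False using dim4 by simp
  qed
  then obtain \<alpha> :: "'a \<Rightarrow> real" where \<alpha>: "linear \<alpha>" "\<And>x. x \<in> span ?U \<Longrightarrow> \<alpha> x = 0" "\<alpha> \<noteq> (\<lambda>x. 0)"
    using functional_vanishing_on_subspace[OF subspace_span] by blast
  note lin = linear_add[OF \<alpha>(1)] linear_diff[OF \<alpha>(1)] linear_scale[OF \<alpha>(1)]
    linear_neg[OF \<alpha>(1)] linear_0[OF \<alpha>(1)]
  define a b c where abc: "a = \<alpha> (br e1 e2)" "b = \<alpha> (br e1 e3)" "c = \<alpha> (br e1 e4)"
  have zu: "\<alpha> u = 0" if "u \<in> ?U" for u using \<alpha>(2)[OF span_base[OF that]] .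
  have abc': "\<alpha> (br e3 e4) = a" "\<alpha> (br e2 e4) = - b" "\<alpha> (br e2 e3) = c"
    using zu[of "br e1 e2 - br e3 e4"] zu[of "br e1 e3 + br e2 e4"] zu[of "br e1 e4 - br e2 e3"]
    by (simp_all add: abc lin)
  have sk: "\<alpha> (br e2 e1) = - a" "\<alpha> (br e3 e1) = - b" "\<alpha> (br e4 e1) = - c"
     "\<alpha> (br e4 e3) = - a" "\<alpha> (br e4 e2) = b" "\<alpha> (br e3 e2) = - c"
    using br_skew[of e2 e1] br_skew[of e3 e1] br_skew[of e4 e1]
      br_skew[of e4 e3] br_skew[of e4 e2] br_skew[of e3 e2]
    by (simp_all add: lin abc abc')
  have N: "a\<^sup>2 + b\<^sup>2 + c\<^sup>2 \<noteq> 0"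
  proof
    assume "a\<^sup>2 + b\<^sup>2 + c\<^sup>2 = 0"
    then have z: "a = 0" "b = 0" "c = 0" by (simp_all add: add_nonneg_eq_0_iff)
    have "x \<in> span {e1, e2, e3, e4}" for x
    proof -
      obtain x1 x2 x3 x4 where x: "x = x1 *\<^sub>R e1 + x2 *\<^sub>R e2 + x3 *\<^sub>R e3 + x4 *\<^sub>R e4" using expand by blast
      show ?thesis unfolding x by (intro span_add span_scale span_base) simp_all
    qed
    then have "x \<in> derived {e1, e2, e3, e4}" for x
      using perf derived_subset_span[of UNIV "{e1, e2, e3, e4}"] by auto
    moreover have "\<alpha> u = 0" if "u \<in> {br x y |x y. x \<in> {e1, e2, e3, e4} \<and> y \<in> {e1, e2, e3, e4}}" for u
      using that abc'[unfolded z] sk[unfolded z] z[unfolded abc] by (auto simp: lin)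
    ultimately have "\<alpha> x = 0" for x
      unfolding derived_def using linear_eq_0_on_span[OF \<alpha>(1)] by blast
    then show False using \<alpha>(3) by auto
  qed
  let ?\<omega> = "\<lambda>x y. \<alpha> (br x y)"
  have nondeg: "x = 0" if x0: "\<And>y. ?\<omega> x y = 0" for x
  proof -
    obtain x1 x2 x3 x4 where x: "x = x1 *\<^sub>R e1 + x2 *\<^sub>R e2 + x3 *\<^sub>R e3 + x4 *\<^sub>R e4" using expand by blast
    have q1: "x2 * a + x3 * b + x4 * c = 0" using x0[of e1] unfolding x by (simp add: lin sk)
    have q2: "x1 * a - x3 * c + x4 * b = 0" using x0[of e2] unfolding x by (simp add: lin sk flip: abc)
    have q3: "x1 * b + x2 * c - x4 * a = 0" using x0[of e3] unfolding x by (simp add: lin sk abc' flip: abc)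
    have q4: "x1 * c - x2 * b + x3 * a = 0" using x0[of e4] unfolding x by (simp add: lin sk abc' flip: abc)
    have "x1 * (a\<^sup>2 + b\<^sup>2 + c\<^sup>2) = 0" "x2 * (a\<^sup>2 + b\<^sup>2 + c\<^sup>2) = 0"
      "x3 * (a\<^sup>2 + b\<^sup>2 + c\<^sup>2) = 0" "x4 * (a\<^sup>2 + b\<^sup>2 + c\<^sup>2) = 0"
      using q1 q2 q3 q4 by algebra+
    then show ?thesis using N x by simp
  qed
  have "symplectic_lie_algebra br ?\<omega>"
    unfolding symplectic_lie_algebra_def
  proof (intro conjI allI)
    show "lie_algebra br" by (rule lie)
    show "bilinear ?\<omega>"
      unfolding bilinear_def by (auto intro!: linearI simp: lin)
    show "nondegenerate_form ?\<omega>"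
      using nondeg by (auto simp: nondegenerate_form_def)
    fix x y z
    show "?\<omega> x y = - ?\<omega> y x" using br_skew[of x y] lin(4) by metis
    have "br (br x y) z + br (br y z) x + br (br z x) y = - (br x (br y z) + br y (br z x) + br z (br x y))"
      using br_skew[of "br x y" z] br_skew[of "br y z" x] br_skew[of "br z x" y] by simp
    then show "?\<omega> (br x y) z + ?\<omega> (br y z) x + ?\<omega> (br z x) y = 0"
      using jacobi[of x y z] by (simp flip: lin(1)) (simp add: lin)
  qed
  then interpret d: symplectic_lie br ?\<omega>
    by unfold_locales
  have "(UNIV::'a set) = {0}"
  proof (rule d.exact_not_unimodular[OF \<alpha>(1) refl symplectic_basis_frame[OF part]])
    show "frame_trace ({..<2} \<times> UNIV) (\<lambda>(i, b). if b then e i else f i)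
        (\<lambda>(i, b) x. if b then \<omega> x (f i) else \<omega> (e i) x) (br x) = 0" for x
      using trace_ad_derived[OF symplectic_basis_frame[OF part], of x UNIV] perf by simp
  qed
  then have "(UNIV::'a set) \<subseteq> span {}" unfolding span_empty by (rule equalityD1)
  then have "dim (UNIV::'a set) \<le> card ({}::'a set)" by (rule dim_le_card) simp
  then show False using dim by simp
qed

text \<open>All brackets of elements of a plane are multiples of a single one, so \<open>J\<close> would be a line.\<close>

lemma plane_perfect_ideal_zero:
  assumes J: "lie_ideal br J" "J \<subseteq> derived J" and dim: "dim J \<le> 2"
  shows "J = {0}"
proof -
  obtain S :: "'a set" where S: "finite S" "span S = UNIV" by (rule finite_dimensional)
  have sJ: "subspace J" using J by (simp add: lie_ideal_def)
  obtain B where B: "B \<subseteq> J" "span B = span J" "finite B" "card B = dim J"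
    using basis_of_subspace[OF S] by blast
  have "\<exists>a b. B \<subseteq> {a, b}"
  proof -
    consider "card B = 0" | "card B = 1" | "card B = 2" using dim B(4) by linarith
    then show ?thesis
      by cases (use B(3) in \<open>auto simp: card_1_singleton_iff card_2_iff\<close>)
  qed
  then obtain a b where ab: "B \<subseteq> {a, b}" by blast
  define u where "u = br a b"
  have "J \<subseteq> derived {a, b}"
    using J(2) derived_subset_span[of J "{a, b}"] B(2) span_mono[OF ab] span_superset[of J] by auto
  also have "\<dots> \<subseteq> span {u}"
    unfolding derived_def
  proof (intro span_minimal subspace_span subsetI)
    fix z assume "z \<in> {br x y |x y. x \<in> {a, b} \<and> y \<in> {a, b}}"
    then have "z = 0 \<or> z = u \<or> z = - u"
      using br_skew[of b a] by (auto simp: u_def)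
    then show "z \<in> span {u}" by (auto intro: span_base span_neg span_zero)
  qed
  finally have Ju: "J \<subseteq> span {u}" .
  show ?thesis
  proof (rule ccontr)
    assume "J \<noteq> {0}"
    then obtain w where w: "w \<in> J" "w \<noteq> 0" using subspace_0[OF sJ] by blast
    obtain k where k: "w = k *\<^sub>R u" using w(1) Ju by (auto simp: span_singleton)
    have "(1 / k) *\<^sub>R w \<in> J" by (rule subspace_scale[OF sJ w(1)])
    then have "u \<in> J" using k w(2) by (cases "k = 0") auto
    then have "br x u \<in> span {u}" for x using J(1) Ju by (auto simp: lie_ideal_def)
    then have "u = 0" using no_ideal_line[of UNIV u] by simp
    then show False using k w(2) by simp
  qed
qed

text \<open>
  What remains is a perfect ideal \<open>J\<close> of dimension 3 in dimension 4. The three brackets of a basis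
  of \<open>J\<close> are again a basis, so a functional \<open>\<alpha>\<close> can be prescribed on them such that
  \<open>\<delta> = \<omega> - \<alpha> [_, _]\<close> vanishes on \<open>J \<times> J\<close>. As \<open>\<delta>\<close> is closed and \<open>J\<close> is spanned by
  brackets \<open>[a, b]\<close> of its elements, \<open>\<delta> [a, b] z\<close> reduces to values on \<open>J \<times> J\<close>, so \<open>\<delta>\<close> also
  pairs \<open>J\<close> trivially with everything. A skew form with a hyperplane in its radical is zero, hence
  \<open>\<omega>\<close> is exact, while \<open>trace_ad_three_dim\<close> shows that the algebra is unimodular.
\<close>

lemma perfect_ideal_zero:
  assumes J: "lie_ideal br J" and perf: "derived J = J"
  shows "J = {0}"
proof (rule ccontr)
  assume "J \<noteq> {0}"
  obtain S :: "'a set" where S: "finite S" "span S = UNIV" by (rule finite_dimensional)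
  have sJ: "subspace J" and iJ: "\<And>x y. y \<in> J \<Longrightarrow> br x y \<in> J" using J by (auto simp: lie_ideal_def)
  have dimJ: "2 < dim J" using plane_perfect_ideal_zero[OF J] perf \<open>J \<noteq> {0}\<close> by fastforce
  have "J \<noteq> UNIV" using dimJ not_perfect perf by auto
  then have lt: "dim J < dim (UNIV::'a set)"
    by (intro dim_less_of_psubset[OF S sJ subspace_UNIV]) auto
  have dim4: "dim (UNIV::'a set) = 4"
    by (rule symplectic_basis_4) (use dimJ lt in linarith)+
  obtain n e f where part: "\<And>x. hyperbolic_part n e f x = x"
    using symplectic_basis_exists[OF subspace_UNIV] form_nondegenerate by (metis UNIV_I)
  have dim3: "dim J = 3" using dimJ lt dim4 by linarith
  obtain P where P: "P \<subseteq> J" "independent P" "span P = span J" "card P = 3"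
    using basis_of_subspace[OF S, of J] dim3 by auto
  obtain p1 p2 p3 where p: "P = {p1, p2, p3}" "distinct [p1, p2, p3]"
    using P(4) by (auto simp: card_3_iff)
  have Jsp: "J = span {p1, p2, p3}" using P(3) p(1) sJ by (metis span_eq_iff)
  have pJ: "p1 \<in> J" "p2 \<in> J" "p3 \<in> J" using P(1) p(1) by auto
  define F1 F2 F3 where F: "F1 = br p2 p3" "F2 = br p3 p1" "F3 = br p1 p2"
  let ?C = "{F1, F2, F3}"
  have CJ: "?C \<subseteq> J" using F pJ iJ by auto
  have "J \<subseteq> derived {p1, p2, p3}" using derived_subset_span[of J "{p1, p2, p3}"] Jsp perf by auto
  also have "\<dots> \<subseteq> span ?C"
    unfolding derived_def
  proof (intro span_minimal subspace_span subsetI)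
    fix z assume "z \<in> {br x y |x y. x \<in> {p1, p2, p3} \<and> y \<in> {p1, p2, p3}}"
    then have "z = 0 \<or> z \<in> ?C \<or> - z \<in> ?C"
      using br_skew[of p2 p1] br_skew[of p3 p2] br_skew[of p1 p3] by (auto simp: F)
    then show "z \<in> span ?C"
      by (metis minus_minus span_base span_neg span_zero)
  qed
  finally have JC: "J \<subseteq> span ?C" .
  have "card ?C \<le> dim J" using dim3 by (simp add: card_insert_if)
  then have indC: "independent ?C" using independent_of_spanning[OF S _ _ JC CJ] by simp
  have "dim J \<le> card ?C" by (rule dim_le_card[OF JC]) simp
  then have dC: "distinct [F1, F2, F3]"
    using \<open>card ?C \<le> dim J\<close> dim3 by (intro card_distinct) simp
  have spC: "span ?C = J" using JC CJ sJ by (simp add: span_minimal subset_antisym)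
  obtain w where w: "w \<notin> J" using \<open>J \<noteq> UNIV\<close> by blast
  have B: "independent {w, F1, F2, F3}" "distinct [w, F1, F2, F3]"
    using indC dC w spC CJ by (auto simp: independent_insertI)
  have spB: "span {w, F1, F2, F3} = UNIV"
    using B dim4 by (intro spanning_of_independent[OF S]) auto
  have B2: "independent {w, p1, p2, p3}" "distinct [w, p1, p2, p3]"
    using P(2) p w Jsp pJ by (auto simp: independent_insertI)
  have spB2: "span {w, p1, p2, p3} = UNIV"
    using B2 dim4 by (intro spanning_of_independent[OF S]) auto
  obtain \<alpha> :: "'a \<Rightarrow> real" where \<alpha>: "linear \<alpha>"
    and \<alpha>F: "\<alpha> F1 = \<omega> p2 p3" "\<alpha> F2 = \<omega> p3 p1" "\<alpha> F3 = \<omega> p1 p2"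
  proof -
    obtain \<alpha> :: "'a \<Rightarrow> real" where "linear \<alpha>"
      "\<forall>y\<in>?C. \<alpha> y = (if y = F1 then \<omega> p2 p3 else if y = F2 then \<omega> p3 p1 else \<omega> p1 p2)"
      using linear_independent_extend[OF indC,
          of "\<lambda>y. if y = F1 then \<omega> p2 p3 else if y = F2 then \<omega> p3 p1 else \<omega> p1 p2"] by blast
    then show thesis using that[of \<alpha>] dC by auto
  qed
  note lin = linear_add[OF \<alpha>] linear_diff[OF \<alpha>] linear_scale[OF \<alpha>] linear_neg[OF \<alpha>] linear_0[OF \<alpha>]
  define \<delta> where "\<delta> x y = \<omega> x y - \<alpha> (br x y)" for x y
  have lin\<delta>: "linear (\<lambda>x. \<delta> x y)" "linear (\<delta> x)" for x y
    by (auto intro!: linearI simp: \<delta>_def lin algebra_simps)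
  have sk\<delta>: "\<delta> x y = - \<delta> y x" for x y
    using form_skew[of x y] br_skew[of x y] lin(4)[of "br y x"] by (simp add: \<delta>_def)
  have closed: "\<delta> (br x y) z + \<delta> (br y z) x + \<delta> (br z x) y = 0" for x y z
  proof -
    have "br (br x y) z + br (br y z) x + br (br z x) y = - (br x (br y z) + br y (br z x) + br z (br x y))"
      using br_skew[of "br x y" z] br_skew[of "br y z" x] br_skew[of "br z x" y] by simp
    then have "\<alpha> (br (br x y) z) + \<alpha> (br (br y z) x) + \<alpha> (br (br z x) y) = 0"
      using jacobi[of x y z] lin(5) by (simp flip: lin(1))
    then show ?thesis using form_closed[of x y z] by (simp add: \<delta>_def)
  qed
  have "\<delta> x y = 0" if "x \<in> {p1, p2, p3}" "y \<in> {p1, p2, p3}" for x y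
    using that \<alpha>F form_skew[of p2 p1] form_skew[of p3 p2] form_skew[of p1 p3]
      br_skew[of p2 p1] br_skew[of p3 p2] br_skew[of p1 p3]
    by (auto simp: \<delta>_def lin simp flip: F)
  then have "\<delta> x y = 0" if "x \<in> {p1, p2, p3}" "y \<in> J" for x y
    using linear_eq_0_on_span[OF lin\<delta>(2), of "{p1, p2, p3}" x y] that Jsp by blast
  then have JJ: "\<delta> x y = 0" if "x \<in> J" "y \<in> J" for x y
    using linear_eq_0_on_span[OF lin\<delta>(1), of "{p1, p2, p3}" y x] that Jsp by blast
  have JU: "\<delta> x z = 0" if "x \<in> J" for x z
  proof -
    have "\<delta> u z = 0" if "u \<in> {br x y |x y. x \<in> J \<and> y \<in> J}" for u
    proof -
      obtain a b where ab: "u = br a b" "a \<in> J" "b \<in> J" using \<open>u \<in> _\<close> by auto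
      have "br z a \<in> J" "br b z \<in> J"
        using ab iJ subspace_neg[OF sJ, of "br z b"] br_skew[of b z] by auto
      then show ?thesis using closed[of a b z] JJ ab by simp
    qed
    moreover have "x \<in> span {br x y |x y. x \<in> J \<and> y \<in> J}" using that perf by (simp add: derived_def)
    ultimately show ?thesis using linear_eq_0_on_span[OF lin\<delta>(1)] by blast
  qed
  have "\<delta> b z = 0" if "b \<in> {w, p1, p2, p3}" for b z
  proof -
    have "\<delta> w c = 0" if "c \<in> {w, p1, p2, p3}" for c
      using that JU[of c w] pJ sk\<delta>[of w c] sk\<delta>[of w w] by auto
    then have "\<delta> w z = 0" using linear_eq_0_on_span[OF lin\<delta>(2), of "{w, p1, p2, p3}" w z] spB2 by blast
    then show ?thesis using that JU pJ by auto
  qed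
  then have "\<delta> x z = 0" for x z
    using linear_eq_0_on_span[OF lin\<delta>(1), of "{w, p1, p2, p3}" z x] spB2 by blast
  then have exact: "\<omega> x y = \<alpha> (br x y)" for x y
    by (simp add: \<delta>_def)
  have "(UNIV::'a set) = {0}"
    by (rule exact_not_unimodular[OF \<alpha> exact symplectic_basis_frame[OF part]])
      (rule trace_ad_three_dim[OF J Jsp B2(1) spB2 B2(2) F B(1) spB B(2) symplectic_basis_frame[OF part]])
  then have "w \<in> {0}" using UNIV_I[of w] by (simp only:)
  then show False using w subspace_0[OF sJ] by simp
qed

end

theorem corollary6p3:
  shows "\<not> (\<exists>(br :: 'a::real_vector \<Rightarrow> 'a \<Rightarrow> 'a) (\<omega> :: 'a \<Rightarrow> 'a \<Rightarrow> real).
           symplectic_lie_algebra br \<omega> \<and>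
           symplectically_irreducible br \<omega> \<and>
           (UNIV :: 'a set) \<noteq> {0} \<and>
           dim (UNIV :: 'a set) < 6)"
proof (intro notI, elim exE conjE)
  fix br :: "'a \<Rightarrow> 'a \<Rightarrow> 'a" and \<omega> :: "'a \<Rightarrow> 'a \<Rightarrow> real"
  assume symp: "symplectic_lie_algebra br \<omega>" and "symplectically_irreducible br \<omega>"
    and nz: "(UNIV :: 'a set) \<noteq> {0}" and "dim (UNIV :: 'a set) < 6"
  moreover have "lie_algebra br"
    using symp unfolding symplectic_lie_algebra_def by blast
  ultimately interpret small_irreducible br \<omega>
    by unfold_locales
  obtain J where J: "lie_ideal br J" "J \<noteq> {0}" "derived J = {0} \<or> derived J = J"
    using abelian_or_perfect_ideal[OF nz] by blast
  have "derived J \<noteq> {0}"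
  proof
    assume "derived J = {0}"
    then have "br x y = 0" if "x \<in> J" "y \<in> J" for x y
      using that span_base[of "br x y" "{br x y |x y. x \<in> J \<and> y \<in> J}"] by (auto simp: derived_def)
    then show False using abelian_ideal_zero[OF J(1)] J(2) by blast
  qed
  then show False using J perfect_ideal_zero by blast
qed

end
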